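(* Let $m,n$ be positive integers and let $\Bbbk$ be an algebraically closed field of characteristic $0$. (1) The edge polytope $P_{K_{m+1,n+1}}$ is unimodularly equivalent to the order polytope $\mathcal{O}(\Pi_{m,n})$. (2) The edge polytope $P_{K_{1,m,n}}$ is unimodularly equivalent to the order polytope $\mathcal{O}(\Pi'_{m,n})$. In particular, the edge ring $\Bbbk[K_{m+1,n+1}]$ (resp. $\Bbbk[K_{1,m,n}]$) is isomorphic to the Hibi ring $\Bbbk[\Pi_{m,n}]$ (resp. $\Bbbk[\Pi'_{m,n}]$).
   Context: $K_{r_1,\ldots,r_k}$ is the complete multipartite graph: vertex set $\bigsqcup_{i=1}^k V_i$ with $|V_i|=r_i$, edges all $\{a,b\}$ with $a\in V_i$, $b\in V_j$, $i\ne j$. For a finite simple graph $G$ on $\{1,\ldots,d\}$, the edge polytope is $P_G=\operatorname{conv}\{\mathbf{e}_i+\mathbf{e}_j:\{i,j\}\in E(G)\}\subset\mathbb{R}^d$, and the edge ring $\Bbbk[G]$ is the subalgebra of $\Bbbk[t_1,\ldots,t_d]$ generated by $t_it_j$, $\{i,j\}\in E(G)$. For a finite poset $\Pi=\{p_1,\ldots,p_N\}$ with order $\prec$, the order polytope is $\mathcal{O}(\Pi)=\{(x_1,\ldots,x_N)\in\mathbb{R}^N: x_i\ge x_j\text{ if }p_i\prec p_j,\ 0\le x_i\le1\text{ for all }i\}$, and the Hibi ring $\Bbbk[\Pi]$ is the $\Bbbk$-algebra generated by the monomials $x_1^{\alpha_1}\cdots x_N^{\alpha_N}t$ for $\alpha\in\mathcal{O}(\Pi)\cap\mathbb{Z}^N$.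 $\Pi_{m,n}=\{p_1,\ldots,p_{m+n}\}$ is the poset whose order is generated by $p_1\prec\cdots\prec p_m$ and $p_{m+1}\prec\cdots\prec p_{m+n}$. $\Pi'_{m,n}$ is the poset on the same set with the additional relation $p_1\prec p_{m+n}$ (and its consequences by transitivity). Two lattice polytopes $P\subset\mathbb{R}^a$ and $Q\subset\mathbb{R}^b$ are unimodularly equivalent if there is an affine isomorphism $\operatorname{aff}(P)\to\operatorname{aff}(Q)$ mapping $\operatorname{aff}(P)\cap\mathbb{Z}^a$ bijectively onto $\operatorname{aff}(Q)\cap\mathbb{Z}^b$ and $P$ onto $Q$. *)

theory Defs
  imports
    "HOL-Analysis.Analysis"
    "HOL-Analysis.Finite_Function_Topology"
    "HOL-Computational_Algebra.Polynomial"
begin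

text \<open>
  \<open>\<real>\<^sup>d\<close> is the space of finitely supported maps \<open>nat \<Rightarrow>\<^sub>0 real\<close> with support in \<open>{1..d}\<close>, so that
  \<open>\<real>\<^sup>a\<close> and \<open>\<real>\<^sup>b\<close> for different numbers \<open>a, b\<close> live in one type and \<open>convex hull\<close>, \<open>affine hull\<close>
  are the library notions. A polynomial is a finitely supported map from exponent vectors to
  coefficients, with the convolution product of the library.
\<close>

type_synonym rvec = "nat \<Rightarrow>\<^sub>0 real"
type_synonym 'k mpoly = "(nat \<Rightarrow>\<^sub>0 nat) \<Rightarrow>\<^sub>0 'k"


subsection \<open>Lattice polytopes and unimodular equivalence\<close>

definition lattice_points :: "rvec set" where
  "lattice_points = {x. \<forall>i. Poly_Mapping.lookup x i \<in> \<int>}"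

definition lattice_polytope :: "rvec set \<Rightarrow> bool" where
  "lattice_polytope P \<longleftrightarrow> (\<exists>S. finite S \<and> S \<subseteq> lattice_points \<and> P = convex hull S)"

definition affine_iso_betw :: "(rvec \<Rightarrow> rvec) \<Rightarrow> rvec set \<Rightarrow> rvec set \<Rightarrow> bool" where
  "affine_iso_betw f A B \<longleftrightarrow> bij_betw f A B \<and>
     (\<forall>x\<in>A. \<forall>y\<in>A. \<forall>u. f ((1 - u) *\<^sub>R x + u *\<^sub>R y) = (1 - u) *\<^sub>R f x + u *\<^sub>R f y)"

definition unimodularly_equivalent :: "rvec set \<Rightarrow> rvec set \<Rightarrow> bool" where
  "unimodularly_equivalent P Q \<longleftrightarrow> lattice_polytope P \<and> lattice_polytope Q \<and>
     (\<exists>f. affine_iso_betw f (affine hull P) (affine hull Q) \<and>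
          bij_betw f (affine hull P \<inter> lattice_points) (affine hull Q \<inter> lattice_points) \<and>
          f ` P = Q)"


subsection \<open>Subalgebras of a polynomial ring\<close>

definition const :: "'k::field \<Rightarrow> 'k mpoly" where
  "const c = Poly_Mapping.single 0 c"

definition monomial :: "(nat \<Rightarrow>\<^sub>0 nat) \<Rightarrow> 'k::field mpoly" where
  "monomial a = Poly_Mapping.single a 1"

definition subalgebra :: "'k::field mpoly set \<Rightarrow> bool" where
  "subalgebra A \<longleftrightarrow> range const \<subseteq> A \<and> (\<forall>p\<in>A. \<forall>q\<in>A. p + q \<in> A \<and> p * q \<in> A)"

definition algebra_isomorphic :: "'k::field mpoly set \<Rightarrow> 'k mpoly set \<Rightarrow> bool" where
  "algebra_isomorphic A B \<longleftrightarrow> (\<exists>f. bij_betw f A B \<and> (\<forall>c. f (const c) = const c) \<and>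
     (\<forall>p\<in>A. \<forall>q\<in>A. f (p + q) = f p + f q \<and> f (p * q) = f p * f q))"


subsection \<open>Graphs, edge polytopes and edge rings\<close>

text \<open>
  A graph on \<open>{1..d}\<close> is given by its set of edges, each a two-element set of vertices. Isolated
  vertices and the number \<open>d\<close> affect only the ambient space of the edge polytope and the
  ambient ring of the edge ring, hence neither of the two objects themselves.
\<close>

definition edge_polytope :: "nat set set \<Rightarrow> rvec set" where
  "edge_polytope E =
     convex hull {Poly_Mapping.single i 1 + Poly_Mapping.single j 1 | i j. {i, j} \<in> E}"

definition edge_ring :: "nat set set \<Rightarrow> 'k::field mpoly set" where
  "edge_ring E = subalgebra hull
     {monomial (Poly_Mapping.single i 1 + Poly_Mapping.single j 1) | i j. {i, j} \<in> E}"

text \<open>The parts of \<open>K\<^bsub>r\<^sub>1,\<dots>,r\<^sub>k\<^esub>\<close> are consecutive blocks of \<open>{1..r\<^sub>1 + \<dots> + r\<^sub>k}\<close>; they are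
  numbered from \<open>0\<close>.\<close>

definition part :: "nat list \<Rightarrow> nat \<Rightarrow> nat set" where
  "part rs i = {sum_list (take i rs) + 1 .. sum_list (take (Suc i) rs)}"

definition complete_multipartite :: "nat list \<Rightarrow> nat set set" where
  "complete_multipartite rs =
     {{a, b} | a b i j. i < length rs \<and> j < length rs \<and> i \<noteq> j \<and> a \<in> part rs i \<and> b \<in> part rs j}"


subsection \<open>Posets, order polytopes and Hibi rings\<close>

text \<open>A poset on \<open>p\<^sub>1, \<dots>, p\<^sub>N\<close> is given by \<open>N\<close> and its strict order \<open>r\<close> on indices:
  \<open>(i, j) \<in> r\<close> means \<open>p\<^sub>i \<prec> p\<^sub>j\<close>.\<close>

definition order_polytope :: "nat \<Rightarrow> nat rel \<Rightarrow> rvec set" where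
  "order_polytope N r = {x. Poly_Mapping.keys x \<subseteq> {1..N} \<and>
     (\<forall>(i, j)\<in>r. Poly_Mapping.lookup x i \<ge> Poly_Mapping.lookup x j) \<and>
     (\<forall>i\<in>{1..N}. 0 \<le> Poly_Mapping.lookup x i \<and> Poly_Mapping.lookup x i \<le> 1)}"

text \<open>The variable with index \<open>0\<close> plays the role of \<open>t\<close>, those with indices \<open>1..N\<close> are
  \<open>x\<^sub>1, \<dots>, x\<^sub>N\<close>. Points of the order polytope have nonnegative coordinates, so its lattice points
  are exactly the images of vectors of natural numbers.\<close>

definition hibi_ring :: "nat \<Rightarrow> nat rel \<Rightarrow> 'k::field mpoly set" where
  "hibi_ring N r = subalgebra hull
     {monomial (\<alpha> + Poly_Mapping.single 0 1) | \<alpha>. Poly_Mapping.map real \<alpha> \<in> order_polytope N r}"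

definition chains_gen :: "nat \<Rightarrow> nat \<Rightarrow> nat rel" where
  "chains_gen m n = {(i, i + 1) | i. 1 \<le> i \<and> i < m} \<union> {(i, i + 1) | i. m + 1 \<le> i \<and> i < m + n}"

definition Pi_order :: "nat \<Rightarrow> nat \<Rightarrow> nat rel" where
  "Pi_order m n = (chains_gen m n)\<^sup>+"

definition Pi'_order :: "nat \<Rightarrow> nat \<Rightarrow> nat rel" where
  "Pi'_order m n = (chains_gen m n \<union> {(1, m + n)})\<^sup>+"


subsection \<open>The encoded objects are a simple graph and strict partial orders\<close>

lemma part_subset:
  assumes "i < length rs"
  shows "part rs i \<subseteq> {1..sum_list rs}"
proof -
  have "sum_list (take (Suc i) rs) + sum_list (drop (Suc i) rs) = sum_list rs"
    by (metis append_take_drop_id sum_list_append)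
  then show ?thesis
    by (auto simp: part_def)
qed

lemma part_disjoint:
  assumes "i \<noteq> j"
  shows "part rs i \<inter> part rs j = {}"
proof -
  have mono: "sum_list (take a rs) \<le> sum_list (take b rs)" if "a \<le> b" for a b
  proof -
    have "take b rs = take a rs @ take (b - a) (drop a rs)"
      by (metis that le_add_diff_inverse take_add)
    then show ?thesis by simp
  qed
  show ?thesis
    using mono[of "Suc i" j] mono[of "Suc j" i] assms
    by (cases i j rule: linorder_cases) (auto simp: part_def)
qed

lemma complete_multipartite_simple:
  assumes "e \<in> complete_multipartite rs"
  shows "e \<subseteq> {1..sum_list rs} \<and> card e = 2"
proof -
  obtain a b i j where e: "e = {a, b}" "i < length rs" "j < length rs" "i \<noteq> j"
      "a \<in> part rs i" "b \<in> part rs j"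
    using assms by (auto simp: complete_multipartite_def)
  have "a \<noteq> b"
    using e part_disjoint[of i j rs] by auto
  then show ?thesis
    using e part_subset[of i rs] part_subset[of j rs] by auto
qed

lemma trancl_below:
  assumes "r \<subseteq> {(i, j). 1 \<le> i \<and> i < j \<and> j \<le> (N::nat)}"
  shows "r\<^sup>+ \<subseteq> {1..N} \<times> {1..N} \<and> irrefl (r\<^sup>+) \<and> trans (r\<^sup>+)"
proof -
  have "1 \<le> i \<and> i < j \<and> j \<le> N" if "(i, j) \<in> r\<^sup>+" for i j
    using that by (induction rule: trancl_induct) (use assms in fastforce)+
  then show ?thesis
    by (fastforce simp: irrefl_def)
qed

lemma Pi_order_strict:
  "Pi_order m n \<subseteq> {1..m + n} \<times> {1..m + n} \<and> irrefl (Pi_order m n) \<and> trans (Pi_order m n)"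
  unfolding Pi_order_def by (rule trancl_below) (auto simp: chains_gen_def)

lemma Pi'_order_strict:
  assumes "m > 0" "n > 0"
  shows "Pi'_order m n \<subseteq> {1..m + n} \<times> {1..m + n} \<and> irrefl (Pi'_order m n) \<and> trans (Pi'_order m n)"
  unfolding Pi'_order_def by (rule trancl_below) (use assms in \<open>auto simp: chains_gen_def\<close>)

end

theory Submission
  imports Defs
begin

text \<open>
  Write \<open>\<chi> i j\<close> for the indicator vector of \<open>{p\<^sub>1, \<dots>, p\<^sub>i} \<union> {p\<^bsub>m+1\<^esub>, \<dots>, p\<^bsub>m+j\<^esub>}\<close>, with \<open>0 \<le> i \<le> m\<close> and
  \<open>0 \<le> j \<le> n\<close>. These are the lattice points of the order polytope of \<open>\<Pi>\<^bsub>m,n\<^esub>\<close>; the relation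
  \<open>p\<^sub>1 \<prec> p\<^bsub>m+n\<^esub>\<close> removes exactly \<open>\<chi> 0 n\<close>. An order polytope is the convex hull of its lattice points.
  The edges of \<open>K\<^bsub>m+1,n+1\<^esub>\<close> are indexed by the same pairs \<open>(i, j)\<close>. Those of \<open>K\<^bsub>1,m,n\<^esub>\<close> arise
  by identifying the vertex \<open>i = 0\<close> of the first part with the vertex \<open>j = n\<close> of the second,
  which turns the edge \<open>(0, n)\<close> into a loop. In both cases the bijection between edge vectors and
  vectors \<open>(1, \<chi> i j)\<close> is induced by a linear map given by partial sums of coordinates, with an
  inverse given by differences. Homogenization by the leading \<open>1\<close> makes the map linear rather than
  affine, so the same map also identifies the monoids of exponents of the edge ring and the Hibi
  ring.
\<close>


subsection \<open>Vectors\<close>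

lemma lookup_scaleR [simp]: "Poly_Mapping.lookup (c *\<^sub>R x) i = c *\<^sub>R Poly_Mapping.lookup x i"
proof -
  have "finite {i. c *\<^sub>R Poly_Mapping.lookup x i \<noteq> 0}"
    by (rule finite_subset[OF _ finite_lookup[of x]]) auto
  then show ?thesis
    by (simp add: scaleR_poly_mapping_def)
qed

lemma lookup_map: "f 0 = 0 \<Longrightarrow> Poly_Mapping.lookup (Poly_Mapping.map f x) i = f (Poly_Mapping.lookup x i)"
  by (simp add: Poly_Mapping.map.rep_eq when_def)

abbreviation real_vec :: "(nat \<Rightarrow>\<^sub>0 nat) \<Rightarrow> rvec" where
  "real_vec \<equiv> Poly_Mapping.map real"

lemma lookup_real_vec [simp]: "Poly_Mapping.lookup (real_vec x) i = real (Poly_Mapping.lookup x i)"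
  by (simp add: lookup_map)

lemma keys_real_vec [simp]: "Poly_Mapping.keys (real_vec x) = Poly_Mapping.keys x"
  by (auto simp: in_keys_iff)

lemma real_vec_add: "real_vec (x + y) = real_vec x + real_vec y"
  by (rule poly_mapping_eqI) (simp add: lookup_add)

lemma inj_real_vec: "inj real_vec"
  by (rule injI) (metis lookup_real_vec of_nat_eq_iff poly_mapping_eqI)

lemma real_vec_lattice: "real_vec x \<in> lattice_points"
  by (simp add: lattice_points_def)


subsection \<open>Unimodular equivalence of convex hulls\<close>

text \<open>Images and preimages of affine sets under \<open>f\<close> are affine, so minimality of
  the hull gives the two inclusions; \<open>f\<close> may include a translation.\<close>

lemma affine_hull_image:
  assumes f: "\<And>x y u. f ((1 - u) *\<^sub>R x + u *\<^sub>R y) = (1 - u) *\<^sub>R f x + u *\<^sub>R f y"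
  shows "affine hull (f ` S) = f ` (affine hull S)"
proof
  have "affine (f ` (affine hull S))"
    by (rule affine_alt[THEN iffD2])
      (auto simp: f[symmetric] intro!: imageI mem_affine[OF affine_affine_hull])
  then show "affine hull (f ` S) \<subseteq> f ` (affine hull S)"
    by (intro hull_minimal image_mono hull_subset)
  have "affine {x. f x \<in> affine hull (f ` S)}"
    by (rule affine_alt[THEN iffD2]) (auto simp: f intro!: mem_affine[OF affine_affine_hull])
  then have "affine hull S \<subseteq> {x. f x \<in> affine hull (f ` S)}"
    by (intro hull_minimal) (auto intro: hull_inc)
  then show "f ` (affine hull S) \<subseteq> affine hull (f ` S)"
    by auto
qed

text \<open>The equivalence is \<open>L\<close> followed by translation by \<open>- c\<close>. The
  condition that \<open>M\<close> undoes \<open>L\<close> is linear, so it spreads from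
  \<open>S\<close> to the affine hull; this gives injectivity, and integrality of \<open>M\<close>
  brings lattice points back. Integrality of \<open>L\<close> is asked only on the affine hull
  because \<open>trip_map\<close> divides by 2.\<close>

lemma unimodularly_equivalent_convex_hulls:
  fixes L M :: "rvec \<Rightarrow> rvec"
  assumes L: "linear L" and M: "linear M"
    and S: "finite S" "S \<subseteq> lattice_points"
    and left_inv: "\<And>x. x \<in> S \<Longrightarrow> M (L x) = x"
    and img: "(+) c ` T = L ` S"
    and c: "c \<in> lattice_points"
    and Lint: "\<And>x. x \<in> affine hull S \<inter> lattice_points \<Longrightarrow> L x \<in> lattice_points"
    and Mint: "\<And>y. y \<in> lattice_points \<Longrightarrow> M y \<in> lattice_points"
  shows "unimodularly_equivalent (convex hull S) (convex hull T)"
proof -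
  define f where "f x = L x - c" for x
  have f: "f ((1 - u) *\<^sub>R x + u *\<^sub>R y) = (1 - u) *\<^sub>R f x + u *\<^sub>R f y" for x y u
    unfolding f_def linear_add[OF L] linear_scale[OF L] by (simp add: algebra_simps)
  have left_inv': "M (L x) = x" if "x \<in> affine hull S" for x
  proof -
    have "affine {x. M (L x) = x}"
      by (auto simp: affine_alt linear_add[OF L] linear_scale[OF L] linear_add[OF M] linear_scale[OF M])
    with left_inv have "affine hull S \<subseteq> {x. M (L x) = x}"
      by (intro hull_minimal) auto
    then show ?thesis using that by auto
  qed
  have add: "a + b \<in> lattice_points" "a - b \<in> lattice_points"
    if "a \<in> lattice_points" "b \<in> lattice_points" for a b
    using that by (auto simp: lattice_points_def lookup_add lookup_minus)
  have T: "T = f ` S"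
  proof -
    have "T = (\<lambda>x. x - c) ` (+) c ` T" by (simp add: image_image)
    then show ?thesis by (simp add: img image_image f_def)
  qed
  have ah: "affine hull T = f ` (affine hull S)"
    unfolding T by (rule affine_hull_image) (rule f)
  have conv: "f ` (convex hull S) = convex hull T"
  proof -
    have "f = (\<lambda>x. (- c) + x) \<circ> L" by (auto simp: f_def)
    then show ?thesis
      by (metis T convex_hull_linear_image[OF L] convex_hull_translation image_comp)
  qed
  have inj: "inj_on f (affine hull S)"
    by (rule inj_on_inverseI[of _ "\<lambda>y. M (y + c)"]) (simp add: f_def left_inv')
  have flat: "f ` (affine hull S \<inter> lattice_points) = affine hull T \<inter> lattice_points" (is "?l = ?r")
  proof
    show "?l \<subseteq> ?r" using Lint c add by (auto simp: ah f_def)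
    show "?r \<subseteq> ?l"
    proof
      fix y assume "y \<in> ?r"
      then obtain x where x: "x \<in> affine hull S" "y = f x" "f x \<in> lattice_points"
        by (auto simp: ah)
      then have "L x \<in> lattice_points" using add(1)[OF x(3) c] by (simp add: f_def)
      then have "x \<in> lattice_points" using Mint left_inv'[OF x(1)] by metis
      then show "y \<in> ?l" using x by auto
    qed
  qed
  have "T \<subseteq> lattice_points"
    using flat hull_subset[of S affine] S T by blast
  then have "lattice_polytope (convex hull S)" "lattice_polytope (convex hull T)"
    using S by (auto simp: lattice_polytope_def T)
  moreover have "affine_iso_betw f (affine hull S) (affine hull T)"
    using inj by (auto simp: affine_iso_betw_def bij_betw_def ah f)
  moreover have "bij_betw f (affine hull S \<inter> lattice_points) (affine hull T \<inter> lattice_points)"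
    using inj flat by (auto simp: bij_betw_def intro: inj_on_subset)
  ultimately show ?thesis
    unfolding unimodularly_equivalent_def affine_hull_convex_hull using conv by blast
qed


subsection \<open>Monomial algebras\<close>

inductive_set generated_monoid :: "'a::monoid_add set \<Rightarrow> 'a set" for G where
  zero: "0 \<in> generated_monoid G"
| add_gen: "a \<in> G \<Longrightarrow> b \<in> generated_monoid G \<Longrightarrow> a + b \<in> generated_monoid G"

lemma generated_monoid_add:
  "a \<in> generated_monoid G \<Longrightarrow> b \<in> generated_monoid G \<Longrightarrow> a + b \<in> generated_monoid G"
  by (induction rule: generated_monoid.induct) (auto simp: add.assoc intro: generated_monoid.intros)

lemma sum_monomials:
  assumes "finite A" "Poly_Mapping.keys p \<subseteq> A"
  shows "(\<Sum>a\<in>A. Poly_Mapping.single a (Poly_Mapping.lookup p a)) = p"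
  using assms by (intro poly_mapping_eqI) (auto simp: lookup_sum lookup_single when_def in_keys_iff)

text \<open>Exponents of a product are sums of exponents, so the right-hand side is a subalgebra.
  Conversely, products of generators give all monomials with exponent in the monoid, and a
  polynomial is a finite sum of constants times monomials.\<close>

lemma subalgebra_hull_monomials:
  "subalgebra hull (monomial ` G) =
     {p :: 'k::field mpoly. Poly_Mapping.keys p \<subseteq> generated_monoid G}" (is "?A = ?B")
proof
  have "subalgebra ?B"
    unfolding subalgebra_def
  proof (intro conjI ballI)
    show "range const \<subseteq> ?B" by (auto simp: const_def generated_monoid.zero split: if_splits)
    show "p + q \<in> ?B" if "p \<in> ?B" "q \<in> ?B" for p q
      using that keys_add[of p q] by blast
    show "p * q \<in> ?B" if "p \<in> ?B" "q \<in> ?B" for p q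
      using that keys_mult[of p q] generated_monoid_add by blast
  qed
  moreover have "a \<in> generated_monoid G" if "a \<in> G" for a
    using generated_monoid.add_gen[OF that generated_monoid.zero] by simp
  ultimately show "?A \<subseteq> ?B"
    by (intro hull_minimal) (auto simp: monomial_def)
  have "subalgebra ?A"
    by (rule hull_in) (auto simp: subalgebra_def)
  then have const: "const c \<in> ?A" and add: "p \<in> ?A \<Longrightarrow> q \<in> ?A \<Longrightarrow> p + q \<in> ?A"
    and mult: "p \<in> ?A \<Longrightarrow> q \<in> ?A \<Longrightarrow> p * q \<in> ?A" for c and p q :: "'k mpoly"
    unfolding subalgebra_def by blast+
  have gen: "monomial a \<in> ?A" if "a \<in> generated_monoid G" for a
    using that
  proof induction
    case zero
    then show ?case using const[of 1] by (simp add: monomial_def const_def)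
  next
    case (add_gen a b)
    then have "monomial a * monomial b \<in> ?A"
      using mult[OF hull_inc[OF imageI]] by blast
    then show ?case by (simp add: monomial_def mult_single)
  qed
  show "?B \<subseteq> ?A"
  proof clarify
    fix p :: "'k mpoly" assume p: "Poly_Mapping.keys p \<subseteq> generated_monoid G"
    have "(\<Sum>a\<in>I. Poly_Mapping.single a (Poly_Mapping.lookup p a)) \<in> ?A"
      if "finite I" "I \<subseteq> generated_monoid G" for I
      using that
    proof (induction I)
      case empty
      then show ?case using const[of 0] by (simp add: const_def)
    next
      case (insert a I)
      then have "const (Poly_Mapping.lookup p a) * monomial a \<in> ?A"
        by (intro mult const gen) auto
      then have "Poly_Mapping.single a (Poly_Mapping.lookup p a) \<in> ?A"
        by (simp add: monomial_def const_def mult_single)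
      then show ?case using insert by (simp add: add)
    qed
    from this[OF _ p] show "p \<in> ?A" by (simp add: sum_monomials)
  qed
qed

section \<open>Algebra maps induced by maps of exponents\<close>

definition relabel :: "('a \<Rightarrow> 'b) \<Rightarrow> ('a \<Rightarrow>\<^sub>0 'k::comm_monoid_add) \<Rightarrow> 'b \<Rightarrow>\<^sub>0 'k" where
  "relabel \<phi> p = (\<Sum>a\<in>Poly_Mapping.keys p. Poly_Mapping.single (\<phi> a) (Poly_Mapping.lookup p a))"

lemma relabel_superset:
  assumes "finite A" "Poly_Mapping.keys p \<subseteq> A"
  shows "relabel \<phi> p = (\<Sum>a\<in>A. Poly_Mapping.single (\<phi> a) (Poly_Mapping.lookup p a))"
  unfolding relabel_def using assms
  by (intro sum.mono_neutral_left) (auto simp: in_keys_iff)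

lemma relabel_single [simp]: "relabel \<phi> (Poly_Mapping.single a c) = Poly_Mapping.single (\<phi> a) c"
  by (subst relabel_superset[of "{a}"]) auto

lemma relabel_add: "relabel \<phi> (p + q) = relabel \<phi> p + relabel \<phi> q"
  using keys_add[of p q]
  by (simp add: relabel_superset[of "Poly_Mapping.keys p \<union> Poly_Mapping.keys q"] lookup_add
      single_add sum.distrib)

lemma relabel_sum: "relabel \<phi> (sum f I) = (\<Sum>i\<in>I. relabel \<phi> (f i))"
proof (induction I rule: infinite_finite_induct)
  case (insert i I)
  then show ?case by (simp add: relabel_add)
qed (simp_all add: relabel_def)

lemma keys_relabel: "Poly_Mapping.keys (relabel \<phi> p) \<subseteq> \<phi> ` Poly_Mapping.keys p"
  unfolding relabel_def by (rule order_trans[OF keys_sum]) auto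

lemma relabel_inverse:
  assumes "\<And>a. a \<in> Poly_Mapping.keys p \<Longrightarrow> \<psi> (\<phi> a) = a"
  shows "relabel \<psi> (relabel \<phi> p) = p"
proof -
  have "relabel \<psi> (relabel \<phi> p) = (\<Sum>a\<in>Poly_Mapping.keys p. Poly_Mapping.single a (Poly_Mapping.lookup p a))"
    by (simp add: relabel_def[of \<phi> p] relabel_sum assms)
  then show ?thesis by (simp add: sum_monomials)
qed

text \<open>Both factors are expanded into single terms. Additivity is asked only for exponents that
  occur, since the map used later is additive only on a generated monoid.\<close>

lemma relabel_mult:
  fixes p q :: "'a::monoid_add \<Rightarrow>\<^sub>0 'k::semiring_0"
  assumes "\<And>a b. a \<in> Poly_Mapping.keys p \<Longrightarrow> b \<in> Poly_Mapping.keys q \<Longrightarrow> \<phi> (a + b) = \<phi> a + \<phi> b"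
  shows "relabel \<phi> (p * q) = relabel \<phi> p * relabel \<phi> q"
proof -
  let ?s = "\<lambda>p a. Poly_Mapping.single a (Poly_Mapping.lookup p a)"
  have "relabel \<phi> (p * q) =
      relabel \<phi> ((\<Sum>a\<in>Poly_Mapping.keys p. ?s p a) * (\<Sum>b\<in>Poly_Mapping.keys q. ?s q b))"
    by (simp add: sum_monomials)
  also have "\<dots> = relabel \<phi> p * relabel \<phi> q"
    by (simp add: sum_product relabel_sum mult_single relabel_def[of _ p] relabel_def[of _ q] assms)
  finally show ?thesis .
qed

lemma generated_monoid_image:
  assumes "\<phi> 0 = 0"
    "\<And>a b. a \<in> generated_monoid G \<Longrightarrow> b \<in> generated_monoid G \<Longrightarrow> \<phi> (a + b) = \<phi> a + \<phi> b"
  shows "generated_monoid (\<phi> ` G) = \<phi> ` generated_monoid G"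
proof -
  have G: "a \<in> generated_monoid G" if "a \<in> G" for a
    using generated_monoid.add_gen[OF that generated_monoid.zero] by simp
  show ?thesis
  proof
    show "generated_monoid (\<phi> ` G) \<subseteq> \<phi> ` generated_monoid G"
    proof
      fix x assume "x \<in> generated_monoid (\<phi> ` G)"
      then show "x \<in> \<phi> ` generated_monoid G"
      proof induction
        case zero
        show ?case by (metis assms(1) generated_monoid.zero imageI)
      next
        case (add_gen x y)
        then obtain a b where "x = \<phi> a" "a \<in> G" "y = \<phi> b" "b \<in> generated_monoid G" by auto
        then show ?case
          using assms(2)[OF G] generated_monoid.add_gen by (metis imageI)
      qed
    qed
    have "\<phi> a \<in> generated_monoid (\<phi> ` G)" if "a \<in> generated_monoid G" for a
      using that by induction (auto simp: assms G intro: generated_monoid.intros)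
    then show "\<phi> ` generated_monoid G \<subseteq> generated_monoid (\<phi> ` G)" by auto
  qed
qed

text \<open>An isomorphism of exponent monoids induces one of their monoid algebras: it relabels
  exponents and keeps coefficients.\<close>

lemma algebra_isomorphic_monomials:
  fixes G :: "(nat \<Rightarrow>\<^sub>0 nat) set"
  assumes add: "\<And>a b. a \<in> generated_monoid G \<Longrightarrow> b \<in> generated_monoid G \<Longrightarrow> \<phi> (a + b) = \<phi> a + \<phi> b"
    and inj: "inj_on \<phi> (generated_monoid G)"
  shows "algebra_isomorphic (subalgebra hull (monomial ` G) :: 'k::field mpoly set)
           (subalgebra hull (monomial ` (\<phi> ` G)))"
proof -
  let ?X = "generated_monoid G"
  have \<phi>0: "\<phi> 0 = 0"
    using add[OF generated_monoid.zero generated_monoid.zero] by simp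
  have img: "generated_monoid (\<phi> ` G) = \<phi> ` ?X"
    by (rule generated_monoid_image[OF \<phi>0 add])
  define \<psi> where "\<psi> = inv_into ?X \<phi>"
  have \<psi>: "\<psi> (\<phi> a) = a" if "a \<in> ?X" for a
    using that inj by (simp add: \<psi>_def)
  have "bij_betw (relabel \<phi>) {p :: 'k mpoly. Poly_Mapping.keys p \<subseteq> ?X}
      {p. Poly_Mapping.keys p \<subseteq> \<phi> ` ?X}"
  proof (rule bij_betw_byWitness[where f' = "relabel \<psi>"])
    show "\<forall>p\<in>{p :: 'k mpoly. Poly_Mapping.keys p \<subseteq> ?X}. relabel \<psi> (relabel \<phi> p) = p"
      by (auto intro!: relabel_inverse \<psi>)
    show "\<forall>p\<in>{p :: 'k mpoly. Poly_Mapping.keys p \<subseteq> \<phi> ` ?X}. relabel \<phi> (relabel \<psi> p) = p"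
      by (intro ballI relabel_inverse) (force simp: \<psi>)
    show "relabel \<phi> ` {p :: 'k mpoly. Poly_Mapping.keys p \<subseteq> ?X} \<subseteq> {p. Poly_Mapping.keys p \<subseteq> \<phi> ` ?X}"
      by (auto dest!: subsetD[OF keys_relabel])
    show "relabel \<psi> ` {p :: 'k mpoly. Poly_Mapping.keys p \<subseteq> \<phi> ` ?X} \<subseteq> {p. Poly_Mapping.keys p \<subseteq> ?X}"
    proof clarify
      fix p :: "'k mpoly" and a
      assume "Poly_Mapping.keys p \<subseteq> \<phi> ` ?X" "a \<in> Poly_Mapping.keys (relabel \<psi> p)"
      then have "a \<in> \<psi> ` \<phi> ` ?X" using subsetD[OF keys_relabel] by fast
      then show "a \<in> ?X" using \<psi> by force
    qed
  qed
  moreover have "relabel \<phi> (const c) = const c" for c :: 'k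
    by (simp add: const_def \<phi>0)
  moreover have "relabel \<phi> (p * q) = relabel \<phi> p * relabel \<phi> q"
    if "Poly_Mapping.keys p \<subseteq> ?X" "Poly_Mapping.keys q \<subseteq> ?X" for p q :: "'k mpoly"
    using that by (intro relabel_mult add) auto
  ultimately show ?thesis
    unfolding algebra_isomorphic_def subalgebra_hull_monomials img
    by (intro exI[of _ "relabel \<phi>"]) (auto simp: relabel_add)
qed

lemma algebra_isomorphic_monomials_linear:
  fixes G H :: "(nat \<Rightarrow>\<^sub>0 nat) set"
  assumes L: "linear L" and M: "linear M"
    and left_inv: "\<And>a. a \<in> G \<Longrightarrow> M (L (real_vec a)) = real_vec a"
    and img: "real_vec ` H = L ` real_vec ` G"
  shows "algebra_isomorphic (subalgebra hull (monomial ` G) :: 'k::field mpoly set)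
           (subalgebra hull (monomial ` H))"
proof -
  \<comment> \<open>\<open>inv real_vec\<close> is meaningful only on vectors with natural entries.
    That \<open>L\<close> yields such vectors is known on \<open>G\<close> from \<open>img\<close>;
    the induction for \<open>*\<close> extends it to the monoid.\<close>
  define \<phi> where "\<phi> = inv real_vec \<circ> L \<circ> real_vec"
  have zero: "real_vec 0 = 0" by (rule poly_mapping_eqI) simp
  have \<phi>G: "real_vec (\<phi> a) = L (real_vec a)" if "a \<in> G" for a
  proof -
    have "L (real_vec a) \<in> range real_vec" using img that by blast
    then show ?thesis by (simp add: \<phi>_def f_inv_into_f)
  qed
  have *: "L (real_vec a) \<in> range real_vec \<and> M (L (real_vec a)) = real_vec a"
    if "a \<in> generated_monoid G" for a
    using that
  proof induction
    case zero
    then show ?case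
      by (auto simp: \<open>real_vec 0 = 0\<close> linear_0[OF L] linear_0[OF M] intro: range_eqI[of _ _ 0])
  next
    case (add_gen a b)
    then have "real_vec (\<phi> a) = L (real_vec a)" "M (L (real_vec a)) = real_vec a"
      using \<phi>G left_inv by auto
    with add_gen.IH show ?case
      by (auto simp: real_vec_add linear_add[OF L] linear_add[OF M] simp flip: \<open>real_vec (\<phi> a) = _\<close>)
        (metis real_vec_add rangeI)
  qed
  then have \<phi>: "real_vec (\<phi> a) = L (real_vec a)" if "a \<in> generated_monoid G" for a
    using that by (simp add: \<phi>_def f_inv_into_f)
  have "\<phi> (a + b) = \<phi> a + \<phi> b" if "a \<in> generated_monoid G" "b \<in> generated_monoid G" for a b
    using that generated_monoid_add[OF that]
    by (intro injD[OF inj_real_vec]) (simp add: \<phi> real_vec_add linear_add[OF L])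
  moreover have "inj_on \<phi> (generated_monoid G)"
    by (intro inj_onI injD[OF inj_real_vec]) (metis * \<phi>)
  moreover have "H = \<phi> ` G"
  proof -
    have "real_vec ` H = real_vec ` \<phi> ` G" by (auto simp: img \<phi>G image_image)
    then show ?thesis by (simp add: inj_image_eq_iff[OF inj_real_vec])
  qed
  ultimately show ?thesis by (simp add: algebra_isomorphic_monomials)
qed


subsection \<open>Order polytopes\<close>

text \<open>Inequalities compose along paths, so later only the generating relations need to be
  examined.\<close>

lemma order_polytope_trancl: "order_polytope N (r\<^sup>+) = order_polytope N r"
proof -
  have "Poly_Mapping.lookup x i \<ge> Poly_Mapping.lookup x j"
    if "(i, j) \<in> r\<^sup>+" "\<forall>(i, j)\<in>r. Poly_Mapping.lookup x i \<ge> Poly_Mapping.lookup x j" for x :: rvec and i j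
    using that(1) by (induction rule: trancl_induct) (use that(2) in \<open>auto intro: order_trans\<close>)
  then show ?thesis
    unfolding order_polytope_def by (blast intro: r_into_trancl')
qed

lemma convex_order_polytope: "convex (order_polytope N r)"
proof (rule convexI)
  fix x y :: rvec and u v :: real
  assume xy: "x \<in> order_polytope N r" "y \<in> order_polytope N r" and uv: "0 \<le> u" "0 \<le> v" "u + v = 1"
  have bounds: "0 \<le> u * Poly_Mapping.lookup x i + v * Poly_Mapping.lookup y i \<and>
      u * Poly_Mapping.lookup x i + v * Poly_Mapping.lookup y i \<le> 1" if "i \<in> {1..N}" for i
  proof -
    have "u * Poly_Mapping.lookup x i \<le> u * 1" "v * Poly_Mapping.lookup y i \<le> v * 1"
      using xy uv that by (intro mult_left_mono; simp add: order_polytope_def)+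
    then show ?thesis using xy uv that by (simp add: order_polytope_def)
  qed
  have "Poly_Mapping.keys (u *\<^sub>R x + v *\<^sub>R y) \<subseteq> {1..N}"
    using xy keys_add[of "u *\<^sub>R x" "v *\<^sub>R y"]
    by (auto simp: order_polytope_def in_keys_iff dest!: subsetD)
  moreover have "u * Poly_Mapping.lookup x i + v * Poly_Mapping.lookup y i \<ge>
      u * Poly_Mapping.lookup x j + v * Poly_Mapping.lookup y j" if "(i, j) \<in> r" for i j
    using xy uv that by (intro add_mono mult_left_mono) (auto simp: order_polytope_def)
  ultimately show "u *\<^sub>R x + v *\<^sub>R y \<in> order_polytope N r"
    using bounds by (auto simp: order_polytope_def lookup_add)
qed

text \<open>If \<open>v < 1\<close> is the least positive coordinate of \<open>x\<close>, then \<open>x = v z + (1 - v) y\<close>, where \<open>z\<close> is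
  the indicator vector of the support of \<open>x\<close> and \<open>y\<close> is a point of the polytope with fewer
  coordinates strictly between \<open>0\<close> and \<open>1\<close>.\<close>

lemma order_polytope_subset_hull:
  "x \<in> order_polytope N r \<Longrightarrow> x \<in> convex hull (order_polytope N r \<inter> lattice_points)"
proof (induction "card {i \<in> Poly_Mapping.keys x. Poly_Mapping.lookup x i < 1}" arbitrary: x rule: less_induct)
  case less
  let ?l = Poly_Mapping.lookup
  let ?F = "\<lambda>x. {i \<in> Poly_Mapping.keys x. ?l x i < 1}"
  have range: "0 \<le> ?l x i" "?l x i \<le> 1" for i
  proof -
    have "?l x i = 0 \<or> i \<in> {1..N}"
      using less.prems by (auto simp: order_polytope_def in_keys_iff)
    then show "0 \<le> ?l x i" "?l x i \<le> 1"
      using less.prems by (auto simp: order_polytope_def)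
  qed
  show ?case
  proof (cases "?F x = {}")
    case True
    have "?l x i \<in> \<int>" for i
    proof (cases "?l x i = 0")
      case False
      then have "?l x i = 1" using True range(2)[of i] by (force simp: in_keys_iff)
      then show ?thesis by simp
    qed simp
    then show ?thesis
      using less.prems by (auto simp: lattice_points_def intro!: hull_inc)
  next
    case False
    define v where "v = Min (?l x ` ?F x)"
    have fin: "finite (?F x)" by simp
    have "v \<in> ?l x ` ?F x"
      unfolding v_def using False fin by (intro Min_in) auto
    then obtain k where k: "k \<in> ?F x" "v = ?l x k"
      by blast
    have v: "0 < v" "v < 1"
      using k range(1)[of k] by (auto simp: in_keys_iff order.strict_iff_order)
    have least: "v \<le> ?l x i" if "?l x i \<noteq> 0" for i
    proof (cases "?l x i < 1")
      case True
      then show ?thesis unfolding v_def using that by (intro Min_le) (auto simp: in_keys_iff)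
    qed (use v in simp)
    define z where "z = Poly_Mapping.map (\<lambda>s::real. if s = 0 then 0 else 1::real) x"
    define y where "y = Poly_Mapping.map (\<lambda>s. if s = 0 then 0 else (s - v) / (1 - v)) x"
    have z: "?l z i = (if ?l x i = 0 then 0 else 1)" for i
      by (simp add: z_def lookup_map)
    have y: "?l y i = (if ?l x i = 0 then 0 else (?l x i - v) / (1 - v))" for i
      by (simp add: y_def lookup_map)
    \<comment> \<open>\<open>z\<close> and \<open>y\<close> apply to each coordinate of
      \<open>x\<close> a function that is nondecreasing on the values that occur; for
      \<open>y\<close> this uses that nonzero coordinates are at least \<open>v\<close>.\<close>
    have mono: "?l z i \<ge> ?l z j \<and> ?l y i \<ge> ?l y j" if "?l x i \<ge> ?l x j" for i j
      using that least[of i] range(1)[of j] v by (auto simp: z y divide_right_mono)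
    have keys: "Poly_Mapping.keys z \<subseteq> Poly_Mapping.keys x" "Poly_Mapping.keys y \<subseteq> Poly_Mapping.keys x"
      by (auto simp: in_keys_iff z y)
    have y01: "0 \<le> ?l y i \<and> ?l y i \<le> 1" for i
      using least[of i] range(2)[of i] v by (auto simp: y)
    have z01: "0 \<le> ?l z i \<and> ?l z i \<le> 1" for i
      by (simp add: z)
    have zO: "z \<in> order_polytope N r" and yO: "y \<in> order_polytope N r"
      using less.prems keys mono y01 z01 unfolding order_polytope_def by blast+
    have "?F y \<subset> ?F x"
    proof
      show "?F y \<subseteq> ?F x" using keys v by (auto simp: y in_keys_iff divide_simps split: if_splits)
      \<comment> \<open>The minimizing coordinate \<open>k\<close> becomes 0 in \<open>y\<close>, so
        the induction measure drops.\<close>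
      have "k \<notin> ?F y" using k by (simp add: y in_keys_iff)
      then show "?F y \<noteq> ?F x" using k by blast
    qed
    then have "y \<in> convex hull (order_polytope N r \<inter> lattice_points)"
      using fin yO by (intro less.hyps psubset_card_mono)
    moreover have "z \<in> convex hull (order_polytope N r \<inter> lattice_points)"
      using zO by (auto simp: lattice_points_def z intro!: hull_inc)
    moreover have "x = v *\<^sub>R z + (1 - v) *\<^sub>R y"
      using v by (intro poly_mapping_eqI) (auto simp: lookup_add z y)
    ultimately show ?thesis
      using v by (metis convexD convex_convex_hull diff_add_cancel add.commute diff_ge_0_iff_ge less_imp_le)
  qed
qed

text \<open>Coordinates are nonnegative, so lattice points of the polytope come from natural
  vectors. The spanning points are thus given by the same vectors as the generators of the Hibi
  ring.\<close>

lemma order_polytope_eq_hull: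
  "order_polytope N r = convex hull (real_vec ` {\<alpha>. real_vec \<alpha> \<in> order_polytope N r})"
proof -
  have "x \<in> real_vec ` {\<alpha>. real_vec \<alpha> \<in> order_polytope N r}"
    if x: "x \<in> order_polytope N r" "x \<in> lattice_points" for x
  proof -
    have "real_vec (Poly_Mapping.map (\<lambda>s. nat \<lfloor>s\<rfloor>) x) = x"
    proof (rule poly_mapping_eqI)
      fix i
      have "i \<in> Poly_Mapping.keys x \<Longrightarrow> i \<in> {1..N}"
        using x(1) by (auto simp: order_polytope_def)
      then have "0 \<le> Poly_Mapping.lookup x i"
        using x(1) by (cases "i \<in> Poly_Mapping.keys x") (auto simp: order_polytope_def in_keys_iff)
      then show "Poly_Mapping.lookup (real_vec (Poly_Mapping.map (\<lambda>s. nat \<lfloor>s\<rfloor>) x)) i = Poly_Mapping.lookup x i"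
        using x(2) by (auto simp: lookup_map lattice_points_def Ints_def dest!: spec[of _ i])
    qed
    then show ?thesis using x(1) by (metis imageI mem_Collect_eq)
  qed
  then have eq: "real_vec ` {\<alpha>. real_vec \<alpha> \<in> order_polytope N r} = order_polytope N r \<inter> lattice_points"
    by (auto simp: real_vec_lattice)
  show ?thesis
    unfolding eq
    by (intro antisym hull_minimal convex_order_polytope) (auto intro: order_polytope_subset_hull)
qed


subsection \<open>Lattice points of the order polytopes of two chains\<close>

text \<open>Truncation at \<open>N\<close> makes the support finite for every \<open>f\<close>;
  index 0 is kept for the homogenizing coordinate.\<close>

definition coord_vec :: "nat \<Rightarrow> (nat \<Rightarrow> 'a::zero) \<Rightarrow> nat \<Rightarrow>\<^sub>0 'a" where
  "coord_vec N f = Abs_poly_mapping (\<lambda>k. if k \<le> N then f k else 0)"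

lemma lookup_coord_vec [simp]: "Poly_Mapping.lookup (coord_vec N f) k = (if k \<le> N then f k else 0)"
proof -
  have "finite {k. (if k \<le> N then f k else 0) \<noteq> 0}"
    by (rule finite_subset[of _ "{..N}"]) auto
  then show ?thesis by (simp add: coord_vec_def)
qed

text \<open>The vector \<chi> i j of the overview, with natural entries so that it is an exponent
  and, through \<open>real_vec\<close>, a point.\<close>

definition ideal_vec :: "nat \<Rightarrow> nat \<Rightarrow> nat \<times> nat \<Rightarrow> nat \<Rightarrow>\<^sub>0 nat" where
  "ideal_vec m n = (\<lambda>(i, j). coord_vec (m + n) (\<lambda>k. if 1 \<le> k \<and> k \<le> i \<or> m + 1 \<le> k \<and> k \<le> m + j then 1 else 0))"

text \<open>Appending a 0 keeps the number \<open>i\<close> of leading ones; appending a 1 forces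
  all earlier values to be 1 and moves the threshold to the end.\<close>

lemma antimono_01_threshold:
  fixes f :: "nat \<Rightarrow> nat"
  assumes "\<And>k. 1 \<le> k \<Longrightarrow> k < m \<Longrightarrow> f (k + 1) \<le> f k" "\<And>k. 1 \<le> k \<Longrightarrow> k \<le> m \<Longrightarrow> f k \<le> 1"
  shows "\<exists>i\<le>m. \<forall>k. 1 \<le> k \<longrightarrow> k \<le> m \<longrightarrow> f k = (if k \<le> i then 1 else 0)"
  using assms
proof (induction m)
  case (Suc m)
  then obtain i where i: "i \<le> m" "\<And>k. 1 \<le> k \<Longrightarrow> k \<le> m \<Longrightarrow> f k = (if k \<le> i then 1 else 0)"
    by force
  show ?case
  proof (cases "f (Suc m) = 0")
    case True
    with i show ?thesis by (intro exI[of _ i]) (auto simp: le_Suc_eq)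
  next
    case False
    then have "f (Suc m) = 1" using Suc.prems(2)[of "Suc m"] by simp
    moreover have "i = m"
    proof (cases "m = 0")
      case False
      then have "f m \<noteq> 0" using Suc.prems(1)[of m] \<open>f (Suc m) = 1\<close> by simp
      then show ?thesis using i False by (metis One_nat_def Suc_leI le_antisym le_refl not_gr_zero)
    qed (use i in simp)
    ultimately show ?thesis using i by (intro exI[of _ "Suc m"]) (auto simp: le_Suc_eq)
  qed
qed simp

text \<open>The inequalities decouple into the two chains, and a 0-1 vector on each chain is given
  by its threshold; the second chain is read with its indices shifted by \<open>m\<close>.\<close>

lemma Pi_order_lattice_points:
  "{\<alpha>. real_vec \<alpha> \<in> order_polytope (m + n) (Pi_order m n)} = ideal_vec m n ` ({..m} \<times> {..n})"
proof (intro equalityI subsetI)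
  fix \<alpha> assume "\<alpha> \<in> {\<alpha>. real_vec \<alpha> \<in> order_polytope (m + n) (Pi_order m n)}"
  then have \<alpha>: "Poly_Mapping.keys \<alpha> \<subseteq> {1..m + n}"
      "\<And>i. 1 \<le> i \<Longrightarrow> i < m \<Longrightarrow> Poly_Mapping.lookup \<alpha> (i + 1) \<le> Poly_Mapping.lookup \<alpha> i"
      "\<And>i. m + 1 \<le> i \<Longrightarrow> i < m + n \<Longrightarrow> Poly_Mapping.lookup \<alpha> (i + 1) \<le> Poly_Mapping.lookup \<alpha> i"
      "\<And>i. 1 \<le> i \<Longrightarrow> i \<le> m + n \<Longrightarrow> Poly_Mapping.lookup \<alpha> i \<le> 1"
    unfolding Pi_order_def order_polytope_trancl
    by (fastforce simp: order_polytope_def chains_gen_def)+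
  obtain i where i: "i \<le> m" "\<And>k. 1 \<le> k \<Longrightarrow> k \<le> m \<Longrightarrow> Poly_Mapping.lookup \<alpha> k = (if k \<le> i then 1 else 0)"
    using antimono_01_threshold[of m "Poly_Mapping.lookup \<alpha>"] \<alpha> by auto
  obtain j where j: "j \<le> n"
      "\<And>k. 1 \<le> k \<Longrightarrow> k \<le> n \<Longrightarrow> Poly_Mapping.lookup \<alpha> (m + k) = (if k \<le> j then 1 else 0)"
    using antimono_01_threshold[of n "\<lambda>k. Poly_Mapping.lookup \<alpha> (m + k)"] \<alpha>(3,4)[of "m + _"]
    by (auto simp: add.assoc)
  have "\<alpha> = ideal_vec m n (i, j)"
  proof (rule poly_mapping_eqI)
    fix k
    consider "k = 0" | "1 \<le> k" "k \<le> m" | "m < k" "k \<le> m + n" | "m + n < k" by linarith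
    then show "Poly_Mapping.lookup \<alpha> k = Poly_Mapping.lookup (ideal_vec m n (i, j)) k"
    proof cases
      case 3
      then show ?thesis using i(1) j(2)[of "k - m"] by (auto simp: ideal_vec_def)
    qed (use \<alpha>(1) i in \<open>auto simp: ideal_vec_def in_keys_iff\<close>)
  qed
  then show "\<alpha> \<in> ideal_vec m n ` ({..m} \<times> {..n})" using i(1) j(1) by auto
next
  fix \<alpha> assume "\<alpha> \<in> ideal_vec m n ` ({..m} \<times> {..n})"
  then show "\<alpha> \<in> {\<alpha>. real_vec \<alpha> \<in> order_polytope (m + n) (Pi_order m n)}"
    unfolding Pi_order_def order_polytope_trancl
    by (auto simp: order_polytope_def chains_gen_def ideal_vec_def
        in_keys_iff split: if_splits)
qed

text \<open>The new relation adds one inequality, between coordinates \<open>1\<close> and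
  \<open>m + n\<close>. On \<chi> i j the former is 1 iff i > 0 and the latter iff j = n, so only
  (0, n) violates it.\<close>

lemma Pi'_order_lattice_points:
  assumes "m > 0" "n > 0"
  shows "{\<alpha>. real_vec \<alpha> \<in> order_polytope (m + n) (Pi'_order m n)} =
    ideal_vec m n ` ({..m} \<times> {..n} - {(0, n)})"
proof -
  have "x \<in> order_polytope (m + n) (Pi'_order m n) \<longleftrightarrow>
      x \<in> order_polytope (m + n) (Pi_order m n) \<and> Poly_Mapping.lookup x 1 \<ge> Poly_Mapping.lookup x (m + n)" for x
    unfolding Pi_order_def Pi'_order_def order_polytope_trancl by (auto simp: order_polytope_def)
  then have "{\<alpha>. real_vec \<alpha> \<in> order_polytope (m + n) (Pi'_order m n)} =
      {\<alpha> \<in> ideal_vec m n ` ({..m} \<times> {..n}). Poly_Mapping.lookup \<alpha> 1 \<ge> Poly_Mapping.lookup \<alpha> (m + n)}"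
    by (simp flip: Pi_order_lattice_points)
  also have "\<dots> = ideal_vec m n ` {p \<in> {..m} \<times> {..n}.
      Poly_Mapping.lookup (ideal_vec m n p) 1 \<ge> Poly_Mapping.lookup (ideal_vec m n p) (m + n)}"
    by blast
  also have "{p \<in> {..m} \<times> {..n}.
      Poly_Mapping.lookup (ideal_vec m n p) 1 \<ge> Poly_Mapping.lookup (ideal_vec m n p) (m + n)} =
      {..m} \<times> {..n} - {(0, n)}"
    using assms by (auto simp: ideal_vec_def split: if_splits)
  finally show ?thesis .
qed

lemma linear_coord_vec:
  fixes g :: "rvec \<Rightarrow> nat \<Rightarrow> real"
  assumes "\<And>k. linear (\<lambda>x. g x k)"
  shows "linear (\<lambda>x. coord_vec N (g x))"
  by (intro linearI poly_mapping_eqI)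
    (simp_all add: lookup_add linear_add[OF assms] linear_scale[OF assms])

lemma linear_lookup: "linear (\<lambda>x::rvec. Poly_Mapping.lookup x k)"
  by (intro linearI) (simp_all add: lookup_add)

lemma lattice_coord_vec: "(\<And>k. f k \<in> \<int>) \<Longrightarrow> coord_vec N f \<in> lattice_points"
  by (simp add: lattice_points_def)

section \<open>Polytopes and rings through common sets of exponents\<close>

definition edge_exponents :: "nat set set \<Rightarrow> (nat \<Rightarrow>\<^sub>0 nat) set" where
  "edge_exponents E = {Poly_Mapping.single i 1 + Poly_Mapping.single j 1 | i j. {i, j} \<in> E}"

lemma edge_polytope_eq_hull: "edge_polytope E = convex hull (real_vec ` edge_exponents E)"
proof -
  have "real_vec (Poly_Mapping.single i 1 + Poly_Mapping.single j 1) =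
      Poly_Mapping.single i 1 + Poly_Mapping.single j 1" for i j
    by (rule poly_mapping_eqI) (simp add: lookup_add lookup_single when_def)
  then show ?thesis
    unfolding edge_polytope_def edge_exponents_def
    by (intro arg_cong[of _ _ "(hull) convex"]) (force simp: image_iff)
qed

lemma edge_ring_eq_hull: "edge_ring E = subalgebra hull (monomial ` edge_exponents E)"
  unfolding edge_ring_def edge_exponents_def
  by (intro arg_cong[of _ _ "(hull) subalgebra"]) blast

definition homogenize :: "(nat \<Rightarrow>\<^sub>0 nat) \<Rightarrow> nat \<Rightarrow>\<^sub>0 nat" where
  "homogenize \<alpha> = \<alpha> + Poly_Mapping.single 0 1"

lemma hibi_ring_eq_hull:
  "hibi_ring N r = subalgebra hull (monomial ` homogenize `
     {\<alpha>. real_vec \<alpha> \<in> order_polytope N r})"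
  unfolding hibi_ring_def
  by (intro arg_cong[of _ _ "(hull) subalgebra"]) (auto simp: homogenize_def)

text \<open>The unit vector added by \<open>homogenize\<close> is a translation for the polytope and
  the factor t for the ring, so one pair \<open>L\<close>, \<open>M\<close> serves both
  criteria.\<close>

lemma edge_polytope_ring_equivalence:
  fixes L M :: "rvec \<Rightarrow> rvec" and e c :: "'i \<Rightarrow> nat \<Rightarrow>\<^sub>0 nat"
  assumes L: "linear L" and M: "linear M" and "finite I"
    and e: "edge_exponents E = e ` I"
    and c: "{\<alpha>. real_vec \<alpha> \<in> order_polytope N r} = c ` I"
    and Le: "\<And>i. i \<in> I \<Longrightarrow> L (real_vec (e i)) = real_vec (homogenize (c i))"
    and Mc: "\<And>i. i \<in> I \<Longrightarrow> M (real_vec (homogenize (c i))) = real_vec (e i)"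
    and L_lattice: "\<And>x. x \<in> affine hull (real_vec ` e ` I) \<inter> lattice_points \<Longrightarrow> L x \<in> lattice_points"
    and M_lattice: "\<And>y. y \<in> lattice_points \<Longrightarrow> M y \<in> lattice_points"
  shows "unimodularly_equivalent (edge_polytope E) (order_polytope N r)"
    and "algebra_isomorphic (edge_ring E :: 'k::field mpoly set) (hibi_ring N r)"
proof -
  have "order_polytope N r = convex hull (real_vec ` c ` I)"
    unfolding c[symmetric] by (rule order_polytope_eq_hull)
  then show "unimodularly_equivalent (edge_polytope E) (order_polytope N r)"
    unfolding edge_polytope_eq_hull e
  proof (elim ssubst)
    show "unimodularly_equivalent (convex hull real_vec ` e ` I) (convex hull real_vec ` c ` I)"
    proof (rule unimodularly_equivalent_convex_hulls[OF L M, where c = "real_vec (Poly_Mapping.single 0 1)"])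
      show "(+) (real_vec (Poly_Mapping.single 0 1)) ` real_vec ` c ` I = L ` real_vec ` e ` I"
        by (auto simp: image_image Le homogenize_def real_vec_add add.commute)
      show "real_vec (Poly_Mapping.single 0 1) \<in> lattice_points"
        by (rule real_vec_lattice)
    qed (use assms in \<open>auto simp: real_vec_lattice\<close>)
  qed
  show "algebra_isomorphic (edge_ring E :: 'k::field mpoly set) (hibi_ring N r)"
    unfolding edge_ring_eq_hull hibi_ring_eq_hull e c
    by (rule algebra_isomorphic_monomials_linear[OF L M]) (auto simp: image_image Le Mc)
qed


subsection \<open>Edge vectors of complete multipartite graphs\<close>

definition edge_vec :: "nat \<Rightarrow> nat \<Rightarrow> nat \<Rightarrow>\<^sub>0 nat" where
  "edge_vec a b = Poly_Mapping.single a 1 + Poly_Mapping.single b 1"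

lemma lookup_edge_vec:
  "Poly_Mapping.lookup (edge_vec a b) k = (if k = a then 1 else 0) + (if k = b then 1 else 0)"
  by (auto simp: edge_vec_def lookup_add lookup_single)

lemma edge_exponents_eq:
  assumes "\<And>e. e \<in> E \<longleftrightarrow> (\<exists>(i, j)\<in>I. e = {v i j, w i j})"
  shows "edge_exponents E = (\<lambda>(i, j). edge_vec (v i j) (w i j)) ` I"
proof (intro equalityI subsetI)
  fix x assume "x \<in> edge_exponents E"
  then obtain a b where x: "x = edge_vec a b" and "{a, b} \<in> E"
    by (auto simp: edge_exponents_def edge_vec_def)
  then obtain i j where ij: "(i, j) \<in> I" "{a, b} = {v i j, w i j}"
    unfolding assms by blast
  then have "edge_vec a b = edge_vec (v i j) (w i j)"
    by (auto simp: doubleton_eq_iff edge_vec_def add.commute)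
  then show "x \<in> (\<lambda>(i, j). edge_vec (v i j) (w i j)) ` I"
    using x ij(1) by force
next
  fix x assume "x \<in> (\<lambda>(i, j). edge_vec (v i j) (w i j)) ` I"
  then obtain i j where "(i, j) \<in> I" "x = edge_vec (v i j) (w i j)" by auto
  moreover from this have "{v i j, w i j} \<in> E" unfolding assms by blast
  ultimately show "x \<in> edge_exponents E"
    unfolding edge_exponents_def edge_vec_def by blast
qed

text \<open>By swapping endpoints each pair of parts is met once; for a list of known length the
  bounded quantifiers unfold into a finite disjunction.\<close>

lemma complete_multipartite_iff:
  "e \<in> complete_multipartite rs \<longleftrightarrow>
     (\<exists>j<length rs. \<exists>i<j. \<exists>a\<in>part rs i. \<exists>b\<in>part rs j. e = {a, b})" (is "_ \<longleftrightarrow> ?r")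
proof
  assume "e \<in> complete_multipartite rs"
  then obtain a b i j where "e = {a, b}" "i < length rs" "j < length rs" "i \<noteq> j"
      "a \<in> part rs i" "b \<in> part rs j"
    by (auto simp: complete_multipartite_def)
  then show ?r
    by (cases i j rule: linorder_cases) (blast, simp, metis insert_commute)
next
  assume ?r
  then obtain j i a b where *: "j < length rs" "i < j" "a \<in> part rs i" "b \<in> part rs j" "e = {a, b}"
    by blast
  then have "i < length rs" "i \<noteq> j" by simp_all
  with * show "e \<in> complete_multipartite rs"
    unfolding complete_multipartite_def by blast
qed

lemma image_plus_atMost: "(+) a ` {..n} = {a..a + n::nat}"
  by (simp add: atMost_atLeast0 image_add_atLeastAtMost)

text \<open>The parts are {1..m+1} and {m+2..m+n+2}; \<open>i\<close> and \<open>j\<close> count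
  their vertices from 0.\<close>

definition bip_edge :: "nat \<Rightarrow> nat \<times> nat \<Rightarrow> nat \<Rightarrow>\<^sub>0 nat" where
  "bip_edge m = (\<lambda>(i, j). edge_vec (1 + i) (m + 2 + j))"

text \<open>An index \<open>i = 0\<close> or \<open>j = n\<close> refers to the vertex \<open>1\<close>, which forms a part of its own; hence
  \<open>(0, n)\<close> is the only pair that does not index an edge.\<close>

definition trip_edge :: "nat \<Rightarrow> nat \<Rightarrow> nat \<times> nat \<Rightarrow> nat \<Rightarrow>\<^sub>0 nat" where
  "trip_edge m n = (\<lambda>(i, j). edge_vec (1 + i) (if j < n then m + 2 + j else 1))"

lemma edge_exponents_bipartite:
  "edge_exponents (complete_multipartite [m + 1, n + 1]) = bip_edge m ` ({..m} \<times> {..n})"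
  unfolding bip_edge_def
proof (rule edge_exponents_eq)
  fix e
  have "part [m + 1, n + 1] 0 = (+) 1 ` {..m}" "part [m + 1, n + 1] 1 = (+) (m + 2) ` {..n}"
    unfolding image_plus_atMost by (simp_all add: part_def)
  then have "e \<in> complete_multipartite [m + 1, n + 1] \<longleftrightarrow>
      (\<exists>a\<in>(+) 1 ` {..m}. \<exists>b\<in>(+) (m + 2) ` {..n}. e = {a, b})"
    by (simp add: complete_multipartite_iff Ex_less_Suc)
  then show "e \<in> complete_multipartite [m + 1, n + 1] \<longleftrightarrow>
      (\<exists>(i, j)\<in>{..m} \<times> {..n}. e = {1 + i, m + 2 + j})"
    by simp
qed

text \<open>Pairs (i, n) with i > 0 join vertex 1 to the second part, pairs (0, j) with j < n join
  it to the third, and the others join the second part to the third.\<close>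

lemma edge_exponents_tripartite:
  "edge_exponents (complete_multipartite [1, m, n]) = trip_edge m n ` ({..m} \<times> {..n} - {(0, n)})"
  unfolding trip_edge_def
proof (rule edge_exponents_eq)
  fix e
  have sh: "{a + 1..a + k} = (\<lambda>i. a + i) ` {1..k}" for a k :: nat
    by (simp add: image_add_atLeastAtMost)
  \<comment> \<open>The third part is counted from 0, as \<open>j = n\<close> is reserved for vertex
    1; the second is counted from 1, as \<open>i = 0\<close> is.\<close>
  have sh': "{a + 1..a + k} = (\<lambda>i. a + 1 + i) ` {..<k}" for a k :: nat
  proof -
    have "{a + 1..a + k} = {a + 1..<a + 1 + k}" by auto
    also have "\<dots> = (+) (a + 1) ` {0..<k}" by (subst image_add_atLeastLessThan) (simp add: add.commute)
    finally show ?thesis by (simp add: lessThan_atLeast0)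
  qed
  have part: "part [1, m, n] 0 = {1}" "part [1, m, n] 1 = (\<lambda>i. 1 + i) ` {1..m}"
    "part [1, m, n] 2 = (\<lambda>j. m + 1 + 1 + j) ` {..<n}"
    unfolding sh[symmetric] sh'[symmetric] by (auto simp: part_def numeral_2_eq_2)
  have "e \<in> complete_multipartite rs \<longleftrightarrow>
      (\<exists>a\<in>part rs 0. \<exists>b\<in>part rs 1. e = {a, b}) \<or> (\<exists>a\<in>part rs 0. \<exists>b\<in>part rs 2. e = {a, b}) \<or>
      (\<exists>a\<in>part rs 1. \<exists>b\<in>part rs 2. e = {a, b})" if "length rs = 3" for rs
    using that by (simp add: complete_multipartite_iff Ex_less_Suc numeral_2_eq_2 numeral_3_eq_3 disj_ac)
  from this[of "[1, m, n]"] have "e \<in> complete_multipartite [1, m, n] \<longleftrightarrow>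
      (\<exists>i\<in>{1..m}. e = {1, 1 + i}) \<or> (\<exists>j\<in>{..<n}. e = {1, m + 1 + 1 + j}) \<or>
      (\<exists>i\<in>{1..m}. \<exists>j\<in>{..<n}. e = {1 + i, m + 1 + 1 + j})"
    unfolding part by (simp only: bex_simps simp_thms list.size)
  also have "\<dots> \<longleftrightarrow> (\<exists>(i, j)\<in>{..m} \<times> {..n} - {(0, n)}. e = {1 + i, if j < n then m + 2 + j else 1})"
    (is "?l \<longleftrightarrow> ?r")
  proof
    assume ?l
    then show ?r
    proof (elim disjE bexE exE conjE)
      fix i assume "i \<in> {1..m}" "e = {1, 1 + i}"
      then show ?r by (intro bexI[of _ "(i, n)"]) auto
    next
      fix j assume "j \<in> {..<n}" "e = {1, m + 1 + 1 + j}"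
      then show ?r by (intro bexI[of _ "(0, j)"]) auto
    next
      fix i j assume "i \<in> {1..m}" "j \<in> {..<n}" "e = {1 + i, m + 1 + 1 + j}"
      then show ?r by (intro bexI[of _ "(i, j)"]) auto
    qed
  next
    assume ?r
    then obtain p where p: "p \<in> {..m} \<times> {..n} - {(0, n)}"
      "case p of (i, j) \<Rightarrow> e = {1 + i, if j < n then m + 2 + j else 1}"
      by blast
    obtain i j where ij: "p = (i, j)" by fastforce
    show ?l
    proof (cases "j < n")
      case True
      then show ?thesis using p ij by (cases "i = 0") auto
    next
      case False
      then have "i \<in> {1..m}" "e = {1, 1 + i}"
        using p ij by (auto simp: insert_commute)
      then show ?thesis by blast
    qed
  qed
  finally show "e \<in> complete_multipartite [1, m, n] \<longleftrightarrow> \<dots>" .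
qed


subsection \<open>The coordinate changes\<close>

text \<open>Coordinate \<open>0\<close> of the target of \<open>bip_map\<close> and \<open>trip_map\<close> homogenizes the order polytope: it
  equals \<open>1\<close> on the edge vectors and plays the role of \<open>t\<close> in the Hibi ring.\<close>

definition bip_map :: "nat \<Rightarrow> nat \<Rightarrow> rvec \<Rightarrow> rvec" where
  "bip_map m n x = coord_vec (m + n) (\<lambda>k.
     if 1 \<le> k \<and> k \<le> m then \<Sum>i=k + 1..m + 1. Poly_Mapping.lookup x i
     else \<Sum>i=k + 2 + (if k = 0 then m else 0)..m + n + 2. Poly_Mapping.lookup x i)"

text \<open>Successive differences along each chain, bordered by coordinate 0 of \<open>y\<close> in
  front and by the value 0 behind. At \<open>k = m + 2\<close> the 0 is an index; in the other
  border cases it is a value.\<close>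

definition bip_inv :: "nat \<Rightarrow> nat \<Rightarrow> rvec \<Rightarrow> rvec" where
  "bip_inv m n y = coord_vec (m + n + 2) (\<lambda>k.
     if k = 0 then 0
     else if k \<le> m + 1
     then Poly_Mapping.lookup y (k - 1) - (if k = m + 1 then 0 else Poly_Mapping.lookup y k)
     else Poly_Mapping.lookup y (if k = m + 2 then 0 else k - 2) -
       (if k = m + n + 2 then 0 else Poly_Mapping.lookup y (k - 1)))"

definition trip_map :: "nat \<Rightarrow> nat \<Rightarrow> rvec \<Rightarrow> rvec" where
  "trip_map m n x = coord_vec (m + n) (\<lambda>k.
     if 1 \<le> k \<and> k \<le> m then \<Sum>i=k + 1..m + 1. Poly_Mapping.lookup x i
     else (\<Sum>i=1..m + n + 1. Poly_Mapping.lookup x i) / 2 - (\<Sum>i=m + 2..k + 1. Poly_Mapping.lookup x i))"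

text \<open>Vertex 1 collects the first difference of the first chain and the last one of the
  second, matching its double role as \<open>i = 0\<close> and \<open>j = n\<close>.\<close>

definition trip_inv :: "nat \<Rightarrow> nat \<Rightarrow> rvec \<Rightarrow> rvec" where
  "trip_inv m n y = coord_vec (m + n + 1) (\<lambda>k.
     if k = 0 then 0
     else if k = 1 then Poly_Mapping.lookup y 0 - Poly_Mapping.lookup y 1 + Poly_Mapping.lookup y (m + n)
     else if k \<le> m + 1
     then Poly_Mapping.lookup y (k - 1) - (if k = m + 1 then 0 else Poly_Mapping.lookup y k)
     else Poly_Mapping.lookup y (if k = m + 2 then 0 else k - 2) - Poly_Mapping.lookup y (k - 1))"

lemma linear_if: "linear f \<Longrightarrow> linear g \<Longrightarrow> linear (\<lambda>x. if b then f x else g x)"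
  by (cases b) simp_all

lemmas linear_coord = linear_coord_vec linear_if linear_compose_sum linear_compose_sub linear_compose_add
  linear_lookup linear_zero

lemma linear_maps: "linear (bip_map m n)" "linear (bip_inv m n)" "linear (trip_map m n)" "linear (trip_inv m n)"
proof -
  have half: "linear f \<Longrightarrow> linear (\<lambda>x. f x / 2)" for f :: "rvec \<Rightarrow> real"
    using linear_compose_scale_right[of f "1 / 2"] by simp
  show "linear (bip_map m n)"
    unfolding bip_map_def[abs_def] by (intro linear_coord ballI)
  show "linear (bip_inv m n)"
    unfolding bip_inv_def[abs_def] by (intro linear_coord)
  show "linear (trip_map m n)"
    unfolding trip_map_def[abs_def] by (intro linear_coord half ballI)
  show "linear (trip_inv m n)"
    unfolding trip_inv_def[abs_def] by (intro linear_coord)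
qed

section \<open>Values of the coordinate changes on edges and indicator vectors\<close>

lemma lookup_homogenized_ideal_vec:
  "Poly_Mapping.lookup (real_vec (homogenize (ideal_vec m n (i, j)))) k =
    (if k = 0 \<or> 1 \<le> k \<and> k \<le> i \<and> k \<le> m + n \<or> m + 1 \<le> k \<and> k \<le> m + j \<and> k \<le> m + n then 1 else 0)"
  by (auto simp: homogenize_def ideal_vec_def lookup_add lookup_single)

lemma lookup_real_edge_vec:
  "Poly_Mapping.lookup (real_vec (edge_vec a b)) k = (if k = a then 1 else 0) + (if k = b then 1 else 0)"
  by (simp add: lookup_edge_vec)

lemma sum_real_edge_vec:
  "(\<Sum>k=u..v. Poly_Mapping.lookup (real_vec (edge_vec a b)) k) =
     (if u \<le> a \<and> a \<le> v then 1 else 0) + (if u \<le> b \<and> b \<le> v then 1 else 0)"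
proof -
  have "(\<Sum>k=u..v. Poly_Mapping.lookup (real_vec (edge_vec a b)) k) =
      (\<Sum>k=u..v. (if k = a then 1 else 0) + (if k = b then 1 else 0))"
    by (intro sum.cong refl lookup_real_edge_vec)
  then show ?thesis by (simp add: sum.distrib)
qed

text \<open>A tail sum over the first part starting at k + 1 contains vertex 1 + i iff k \<le> i;
  one over the second part starting at k + 2 contains m + 2 + j iff k \<le> m + j. For k = 0 the sum
  runs over the whole second part, which meets each edge once.\<close>

lemma bip_map_edge:
  assumes "p \<in> {..m} \<times> {..n}"
  shows "bip_map m n (real_vec (bip_edge m p)) = real_vec (homogenize (ideal_vec m n p))"
  using assms
  by (intro poly_mapping_eqI)
    (auto simp: bip_map_def bip_edge_def lookup_homogenized_ideal_vec sum_real_edge_vec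
      simp del: lookup_real_vec sum.cl_ivl_Suc)

lemma bip_inv_ideal:
  assumes "p \<in> {..m} \<times> {..n}" "m > 0" "n > 0"
  shows "bip_inv m n (real_vec (homogenize (ideal_vec m n p))) = real_vec (bip_edge m p)"
  using assms
  by (intro poly_mapping_eqI)
    (auto simp: bip_inv_def bip_edge_def lookup_homogenized_ideal_vec lookup_real_edge_vec
      simp del: lookup_real_vec)

text \<open>Half the coordinate sum is 1 on every edge. The second chain uses 1 minus an initial sum
  over the third part, because for j = n no vertex of that part occurs and all entries must be
  1.\<close>

lemma trip_map_edge:
  assumes "p \<in> {..m} \<times> {..n} - {(0, n)}"
  shows "trip_map m n (real_vec (trip_edge m n p)) = real_vec (homogenize (ideal_vec m n p))"
  using assms
  by (intro poly_mapping_eqI)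
    (cases "snd p < n"; cases "fst p = 0"; auto simp: trip_map_def trip_edge_def lookup_homogenized_ideal_vec sum_real_edge_vec
      simp del: lookup_real_vec sum.cl_ivl_Suc)

lemma trip_inv_ideal:
  assumes "p \<in> {..m} \<times> {..n} - {(0, n)}" "m > 0" "n > 0"
  shows "trip_inv m n (real_vec (homogenize (ideal_vec m n p))) = real_vec (trip_edge m n p)"
  using assms
  by (intro poly_mapping_eqI)
    (cases "snd p < n"; cases "fst p = 0"; auto simp: trip_inv_def trip_edge_def lookup_homogenized_ideal_vec lookup_real_edge_vec
      split: if_splits simp del: lookup_real_vec)

lemma lattice_maps:
  assumes "x \<in> lattice_points"
  shows "bip_map m n x \<in> lattice_points" "bip_inv m n x \<in> lattice_points" "trip_inv m n x \<in> lattice_points"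
  using assms unfolding bip_map_def bip_inv_def trip_inv_def
  by (auto intro!: lattice_coord_vec simp: lattice_points_def)

text \<open>The halved coordinate sum is the only source of fractions. The sum is 2 on all edge
  vectors, an affine condition, hence 2 on their affine hull.\<close>

lemma trip_map_lattice:
  assumes "x \<in> affine hull (real_vec ` trip_edge m n ` ({..m} \<times> {..n} - {(0, n)}))"
    and "x \<in> lattice_points"
  shows "trip_map m n x \<in> lattice_points"
proof -
  let ?s = "\<lambda>x::rvec. \<Sum>i=1..m + n + 1. Poly_Mapping.lookup x i"
  have "affine {x. ?s x = 2}"
  proof (rule affine_alt[THEN iffD2], intro ballI allI CollectI)
    fix x y :: rvec and u :: real
    assume "x \<in> {x. ?s x = 2}" "y \<in> {x. ?s x = 2}"
    moreover have "?s ((1 - u) *\<^sub>R x + u *\<^sub>R y) = (1 - u) * ?s x + u * ?s y"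
      by (simp add: lookup_add sum.distrib sum_distrib_left del: sum.cl_ivl_Suc)
    ultimately show "?s ((1 - u) *\<^sub>R x + u *\<^sub>R y) = 2"
      by simp
  qed
  then have "affine hull (real_vec ` trip_edge m n ` ({..m} \<times> {..n} - {(0, n)})) \<subseteq> {x. ?s x = 2}"
    by (intro hull_minimal)
      (auto simp: trip_edge_def sum_real_edge_vec split: if_splits simp del: lookup_real_vec sum.cl_ivl_Suc)
  then have "?s x = 2"
    using assms(1) by blast
  then show ?thesis
    unfolding trip_map_def using assms(2)
    by (auto intro!: lattice_coord_vec simp: lattice_points_def simp del: sum.cl_ivl_Suc)
qed


theorem proposition2p2:
  fixes m n :: nat
  assumes "m > 0" and "n > 0"
  shows "unimodularly_equivalent (edge_polytope (complete_multipartite [m + 1, n + 1]))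
           (order_polytope (m + n) (Pi_order m n)) \<and>
         unimodularly_equivalent (edge_polytope (complete_multipartite [1, m, n]))
           (order_polytope (m + n) (Pi'_order m n)) \<and>
         algebra_isomorphic
           (edge_ring (complete_multipartite [m + 1, n + 1])
             :: 'k::{alg_closed_field, field_char_0} mpoly set)
           (hibi_ring (m + n) (Pi_order m n)) \<and>
         algebra_isomorphic
           (edge_ring (complete_multipartite [1, m, n]) :: 'k mpoly set)
           (hibi_ring (m + n) (Pi'_order m n))"
proof -
  let ?I = "{..m} \<times> {..n}"
  have fin: "finite ?I" "finite (?I - {(0, n)})" by auto
  have "unimodularly_equivalent (edge_polytope (complete_multipartite [m + 1, n + 1]))
      (order_polytope (m + n) (Pi_order m n)) \<and>
    algebra_isomorphic (edge_ring (complete_multipartite [m + 1, n + 1]) :: 'k mpoly set)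
      (hibi_ring (m + n) (Pi_order m n))"
    by (intro conjI edge_polytope_ring_equivalence[OF linear_maps(1,2)[of m n] fin(1)
          edge_exponents_bipartite Pi_order_lattice_points])
      (use assms in \<open>simp_all only: bip_map_edge bip_inv_ideal lattice_maps Int_iff\<close>)
  moreover have "unimodularly_equivalent (edge_polytope (complete_multipartite [1, m, n]))
      (order_polytope (m + n) (Pi'_order m n)) \<and>
    algebra_isomorphic (edge_ring (complete_multipartite [1, m, n]) :: 'k mpoly set)
      (hibi_ring (m + n) (Pi'_order m n))"
    by (intro conjI edge_polytope_ring_equivalence[OF linear_maps(3,4)[of m n] fin(2)
          edge_exponents_tripartite Pi'_order_lattice_points[OF assms]])
      (use assms in \<open>simp_all only: trip_map_edge trip_inv_ideal lattice_maps trip_map_lattice Int_iff\<close>)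
  ultimately show ?thesis by blast
qed

end
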